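(* Let $\Gamma$ be a directed graph, $I(\Gamma)$ its graph inverse semigroup, and $p$ a directed path in $\Gamma$. Then the local submonoid of $I(\Gamma)$ at the idempotent $pp^*$ is $$pp^*I(\Gamma)pp^*=\{0\}\cup\{(p\mu)(p\nu)^* : \mu,\nu \text{ directed paths in }\Gamma \text{ with } r(\mu)=r(\nu) \text{ and } s(\mu)=s(\nu)=r(p)\}.$$
   Context: A directed graph $\Gamma$ consists of a non-empty set $\Gamma^0$ of vertices, a possibly empty set $\Gamma^1$ of edges, and source and range maps $s,r:\Gamma^1\to\Gamma^0$. A directed path is either a vertex $v$ (trivial path, $s(v)=r(v)=v$) or a finite sequence $p=e_1e_2\cdots e_n$ of edges with $r(e_i)=s(e_{i+1})$ for $1\le i\le n-1$; then $s(p)=s(e_1)$ and $r(p)=r(e_n)$. If $r(p)=s(\mu)$, then $p\mu$ denotes the concatenated path. For each edge $e$ there is an inverse (ghost) edge $e^*$ with $s(e^* )=r(e)$, $r(e^* )=s(e)$; $(\Gamma^1)^*$ is the set of ghost edges. For a path $p=e_1\cdots e_n$, $p^*=e_n^*\cdots e_1^*$, and $v^*=v$ for a vertex $v$. The graph inverse semigroup $I(\Gamma)$ is the semigroup with zero $0$ generated by $\Gamma^0\cup\Gamma^1\cup(\Gamma^1)^*$ subject to the relations: (1) $s(e)e=e=e\,r(e)$ for all $e\in\Gamma^0\cup\Gamma^1\cup(\Gamma^1)^*$; (2) $uv=u$ if $u=v$ and $uv=0$ if $u\neq v$, for all $u,v\in\Gamma^0$; (3) $e^*f=r(e)$ if $e=f$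 and $e^*f=0$ if $e\ne f$, for all $e,f\in\Gamma^1$. The zero element is always included in $I(\Gamma)$. The local submonoid at an idempotent $f$ is $fI(\Gamma)f=\{fxf: x\in I(\Gamma)\}$. *)

theory Defs
  imports "Graph_Theory.Arc_Walk"
begin

text \<open>
  Directed graphs are those of \<open>Graph_Theory\<close>: \<open>tail\<close> is the source map and \<open>head\<close> the range map.
  They may be infinite and may have loops and parallel edges.
\<close>

subsection \<open>Directed paths\<close>

text \<open>
  A path is a pair of its source vertex and its list of edges. The trivial path at \<open>v\<close> is
  \<open>(v, [])\<close>; for a nonempty list of edges the source is determined by the first edge, so every
  path has exactly one representation.
\<close>

type_synonym ('a, 'b) dpath = "'a \<times> 'b list"

definition dpaths :: "('a, 'b) pre_digraph \<Rightarrow> ('a, 'b) dpath set" where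
  "dpaths G = {(u, es) | u es. \<exists>v. pre_digraph.awalk G u es v}"

definition path_src :: "('a, 'b) dpath \<Rightarrow> 'a" where
  "path_src p = fst p"

definition path_rng :: "('a, 'b) pre_digraph \<Rightarrow> ('a, 'b) dpath \<Rightarrow> 'a" where
  "path_rng G p = pre_digraph.awlast G (fst p) (snd p)"

text \<open>Concatenation is meant only for \<open>path_rng G p = path_src q\<close>.\<close>

definition path_cat :: "('a, 'b) dpath \<Rightarrow> ('a, 'b) dpath \<Rightarrow> ('a, 'b) dpath" where
  "path_cat p q = (fst p, snd p @ snd q)"

subsection \<open>The graph inverse semigroup as a presentation\<close>

datatype ('a, 'b) igs_gen = Vertex 'a | Edge 'b | Ghost 'b

fun gen_src :: "('a, 'b) pre_digraph \<Rightarrow> ('a, 'b) igs_gen \<Rightarrow> 'a" where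
  "gen_src G (Vertex v) = v"
| "gen_src G (Edge e) = tail G e"
| "gen_src G (Ghost e) = head G e"

fun gen_rng :: "('a, 'b) pre_digraph \<Rightarrow> ('a, 'b) igs_gen \<Rightarrow> 'a" where
  "gen_rng G (Vertex v) = v"
| "gen_rng G (Edge e) = head G e"
| "gen_rng G (Ghost e) = tail G e"

definition igs_gens :: "('a, 'b) pre_digraph \<Rightarrow> ('a, 'b) igs_gen set" where
  "igs_gens G = Vertex ` verts G \<union> Edge ` arcs G \<union> Ghost ` arcs G"

text \<open>
  The free semigroup with zero on a set: nonempty words over the set, together with \<open>None\<close>
  as an adjoined zero.
\<close>

definition free_sg0 :: "'x set \<Rightarrow> 'x list option set" where
  "free_sg0 X = insert None (Some ` (lists X - {[]}))"

fun free_mult :: "'x list option \<Rightarrow> 'x list option \<Rightarrow> 'x list option" where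
  "free_mult (Some xs) (Some ys) = Some (xs @ ys)"
| "free_mult _ _ = None"

text \<open>The defining relations; in the first two, \<open>x\<close> ranges over all generators.\<close>

inductive_set igs_rel ::
  "('a, 'b) pre_digraph \<Rightarrow> (('a, 'b) igs_gen list option \<times> ('a, 'b) igs_gen list option) set"
  for G :: "('a, 'b) pre_digraph" where
  src: "x \<in> igs_gens G \<Longrightarrow> (Some [Vertex (gen_src G x), x], Some [x]) \<in> igs_rel G"
| rng: "x \<in> igs_gens G \<Longrightarrow> (Some [x, Vertex (gen_rng G x)], Some [x]) \<in> igs_rel G"
| vertex_same: "u \<in> verts G \<Longrightarrow> (Some [Vertex u, Vertex u], Some [Vertex u]) \<in> igs_rel G"
| vertex_diff: "u \<in> verts G \<Longrightarrow> v \<in> verts G \<Longrightarrow> u \<noteq> v \<Longrightarrow>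
    (Some [Vertex u, Vertex v], None) \<in> igs_rel G"
| ghost_same: "e \<in> arcs G \<Longrightarrow> (Some [Ghost e, Edge e], Some [Vertex (head G e)]) \<in> igs_rel G"
| ghost_diff: "e \<in> arcs G \<Longrightarrow> f \<in> arcs G \<Longrightarrow> e \<noteq> f \<Longrightarrow>
    (Some [Ghost e, Edge f], None) \<in> igs_rel G"

text \<open>The congruence on the free semigroup with zero generated by the defining relations.\<close>

inductive_set igs_cong ::
  "('a, 'b) pre_digraph \<Rightarrow> (('a, 'b) igs_gen list option \<times> ('a, 'b) igs_gen list option) set"
  for G :: "('a, 'b) pre_digraph" where
  base: "(x, y) \<in> igs_rel G \<Longrightarrow> (x, y) \<in> igs_cong G"
| refl: "x \<in> free_sg0 (igs_gens G) \<Longrightarrow> (x, x) \<in> igs_cong G"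
| sym: "(x, y) \<in> igs_cong G \<Longrightarrow> (y, x) \<in> igs_cong G"
| trans: "(x, y) \<in> igs_cong G \<Longrightarrow> (y, z) \<in> igs_cong G \<Longrightarrow> (x, z) \<in> igs_cong G"
| mult: "(x, x') \<in> igs_cong G \<Longrightarrow> (y, y') \<in> igs_cong G \<Longrightarrow>
    (free_mult x y, free_mult x' y') \<in> igs_cong G"

type_synonym ('a, 'b) igs_elem = "('a, 'b) igs_gen list option set"

definition igs_class ::
  "('a, 'b) pre_digraph \<Rightarrow> ('a, 'b) igs_gen list option \<Rightarrow> ('a, 'b) igs_elem" where
  "igs_class G w = igs_cong G `` {w}"

definition igs :: "('a, 'b) pre_digraph \<Rightarrow> ('a, 'b) igs_elem set" where
  "igs G = free_sg0 (igs_gens G) // igs_cong G"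

definition igs_zero :: "('a, 'b) pre_digraph \<Rightarrow> ('a, 'b) igs_elem" where
  "igs_zero G = igs_class G None"

definition igs_mult ::
  "('a, 'b) pre_digraph \<Rightarrow> ('a, 'b) igs_elem \<Rightarrow> ('a, 'b) igs_elem \<Rightarrow> ('a, 'b) igs_elem" where
  "igs_mult G X Y = (\<Union>x\<in>X. \<Union>y\<in>Y. igs_class G (free_mult x y))"

text \<open>The elements of the semigroup given by a path \<open>p\<close> and by its formal inverse \<open>p\<^sup>*\<close>.\<close>

definition path_elem ::
  "('a, 'b) pre_digraph \<Rightarrow> ('a, 'b) dpath \<Rightarrow> ('a, 'b) igs_elem" where
  "path_elem G p = igs_class G
     (Some (if snd p = [] then [Vertex (fst p)] else map Edge (snd p)))"

definition path_star ::
  "('a, 'b) pre_digraph \<Rightarrow> ('a, 'b) dpath \<Rightarrow> ('a, 'b) igs_elem" where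
  "path_star G p = igs_class G
     (Some (if snd p = [] then [Vertex (fst p)] else rev (map Ghost (snd p))))"

definition local_submonoid ::
  "('a, 'b) pre_digraph \<Rightarrow> ('a, 'b) igs_elem \<Rightarrow> ('a, 'b) igs_elem set" where
  "local_submonoid G f = {igs_mult G (igs_mult G f x) f | x. x \<in> igs G}"

subsection \<open>Well-definedness\<close>

lemma gens_iff [simp]:
  "Vertex v \<in> igs_gens G \<longleftrightarrow> v \<in> verts G"
  "Edge e \<in> igs_gens G \<longleftrightarrow> e \<in> arcs G"
  "Ghost e \<in> igs_gens G \<longleftrightarrow> e \<in> arcs G"
  by (auto simp: igs_gens_def)

lemma Some_free_sg0_iff [simp]: "Some w \<in> free_sg0 X \<longleftrightarrow> w \<noteq> [] \<and> set w \<subseteq> X"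
  by (auto simp: free_sg0_def)

lemma None_free_sg0 [simp]: "None \<in> free_sg0 X"
  by (simp add: free_sg0_def)

lemma free_mult_closed:
  "x \<in> free_sg0 X \<Longrightarrow> y \<in> free_sg0 X \<Longrightarrow> free_mult x y \<in> free_sg0 X"
  by (cases x; cases y) auto

lemma free_mult_assoc: "free_mult (free_mult x y) z = free_mult x (free_mult y z)"
  by (cases x; cases y; cases z) auto

lemma igs_rel_closed:
  assumes "wf_digraph G" and "(x, y) \<in> igs_rel G"
  shows "x \<in> free_sg0 (igs_gens G) \<and> y \<in> free_sg0 (igs_gens G)"
proof -
  interpret wf_digraph G by fact
  show ?thesis
    using assms(2) by cases (auto simp: igs_gens_def)
qed

lemma igs_cong_closed:
  assumes "wf_digraph G" and "(x, y) \<in> igs_cong G"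
  shows "x \<in> free_sg0 (igs_gens G) \<and> y \<in> free_sg0 (igs_gens G)"
  using assms(2)
  by induction (use igs_rel_closed[OF assms(1)] free_mult_closed in blast)+

lemma igs_cong_equiv:
  assumes "wf_digraph G"
  shows "equiv (free_sg0 (igs_gens G)) (igs_cong G)"
  using igs_cong_closed[OF assms]
  by (auto intro!: equivI refl_onI symI transI intro: igs_cong.refl igs_cong.sym igs_cong.trans)

lemma igs_mult_class:
  assumes "wf_digraph G" "x \<in> free_sg0 (igs_gens G)" "y \<in> free_sg0 (igs_gens G)"
  shows "igs_mult G (igs_class G x) (igs_class G y) = igs_class G (free_mult x y)"
proof
  show "igs_mult G (igs_class G x) (igs_class G y) \<subseteq> igs_class G (free_mult x y)"
    unfolding igs_mult_def igs_class_def
    by (auto intro: igs_cong.trans igs_cong.mult)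
  show "igs_class G (free_mult x y) \<subseteq> igs_mult G (igs_class G x) (igs_class G y)"
    using assms(2,3) unfolding igs_mult_def igs_class_def
    by (auto intro: igs_cong.refl)
qed

lemma igs_class_eqI:
  assumes "wf_digraph G" "(x, y) \<in> igs_cong G"
  shows "igs_class G x = igs_class G y"
  unfolding igs_class_def by (rule equiv_class_eq[OF igs_cong_equiv[OF assms(1)] assms(2)])

lemma path_elem_star_closed:
  assumes "wf_digraph G" "p \<in> dpaths G"
  shows "path_elem G p \<in> igs G" "path_star G p \<in> igs G"
proof -
  have "fst p \<in> verts G" "set (snd p) \<subseteq> arcs G"
    using assms(2) by (auto simp: dpaths_def pre_digraph.awalk_def)
  then show "path_elem G p \<in> igs G" "path_star G p \<in> igs G"
    unfolding path_elem_def path_star_def igs_class_def igs_def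
    by (auto intro!: quotientI simp: subset_iff)
qed

lemma igs_cong_append:
  assumes "(Some a, Some a') \<in> igs_cong G" "(Some b, Some b') \<in> igs_cong G"
  shows "(Some (a @ b), Some (a' @ b')) \<in> igs_cong G"
  using igs_cong.mult[OF assms] by simp

lemma edges_absorb_source:
  assumes "wf_digraph G" "pre_digraph.awalk G u es v" "es \<noteq> []"
  shows "(Some (Vertex u # map Edge es), Some (map Edge es)) \<in> igs_cong G"
proof -
  interpret wf_digraph G by fact
  obtain e fs where es: "es = e # fs" using assms(3) by (cases es) auto
  have e: "e \<in> arcs G" "tail G e = u" "set fs \<subseteq> arcs G"
    using assms(2) by (auto simp: es awalk_def)
  have 1: "(Some [Vertex u, Edge e], Some [Edge e]) \<in> igs_cong G"
    using igs_cong.base[OF igs_rel.src[of "Edge e" G]] e by simp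
  show ?thesis
  proof (cases "fs = []")
    case True
    then show ?thesis using 1 by (simp add: es)
  next
    case False
    have "(Some (map Edge fs), Some (map Edge fs)) \<in> igs_cong G"
      using False e by (intro igs_cong.refl) auto
    from igs_cong_append[OF 1 this] show ?thesis by (simp add: es)
  qed
qed

lemma edges_absorb_range:
  assumes "wf_digraph G" "pre_digraph.awalk G u es v" "es \<noteq> []"
  shows "(Some (map Edge es @ [Vertex v]), Some (map Edge es)) \<in> igs_cong G"
proof -
  interpret wf_digraph G by fact
  obtain e fs where es: "es = fs @ [e]" using assms(3) by (cases es rule: rev_cases) auto
  have e: "e \<in> arcs G" "head G e = v" "set fs \<subseteq> arcs G"
    using assms(2) by (auto simp: es awalk_Cons_iff awalk_def)
  have 1: "(Some [Edge e, Vertex v], Some [Edge e]) \<in> igs_cong G"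
    using igs_cong.base[OF igs_rel.rng[of "Edge e" G]] e by simp
  show ?thesis
  proof (cases "fs = []")
    case True
    then show ?thesis using 1 by (simp add: es)
  next
    case False
    have "(Some (map Edge fs), Some (map Edge fs)) \<in> igs_cong G"
      using False e by (intro igs_cong.refl) auto
    from igs_cong_append[OF this 1] show ?thesis by (simp add: es)
  qed
qed

lemma ghosts_edges_cancel:
  assumes "wf_digraph G" "pre_digraph.awalk G u es v" "es \<noteq> []"
  shows "(Some (rev (map Ghost es) @ map Edge es), Some [Vertex v]) \<in> igs_cong G"
  using assms(2,3)
proof (induction es arbitrary: u)
  case Nil
  then show ?case by simp
next
  case (Cons e es)
  interpret wf_digraph G by fact
  have e: "e \<in> arcs G" and es: "awalk (head G e) es v"
    using Cons.prems by (auto simp: awalk_Cons_iff)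
  have 1: "(Some [Ghost e, Edge e], Some [Vertex (head G e)]) \<in> igs_cong G"
    by (intro igs_cong.base igs_rel.ghost_same e)
  show ?case
  proof (cases "es = []")
    case True
    then show ?thesis using 1 es by (auto simp: awalk_def)
  next
    case False
    have set_es: "set es \<subseteq> arcs G" using es by (auto simp: awalk_def)
    have g: "(Some (rev (map Ghost es)), Some (rev (map Ghost es))) \<in> igs_cong G"
      and f: "(Some (map Edge es), Some (map Edge es)) \<in> igs_cong G"
      using False set_es by (auto intro!: igs_cong.refl simp: subset_iff)
    have "(Some (rev (map Ghost es) @ [Ghost e, Edge e] @ map Edge es),
           Some (rev (map Ghost es) @ [Vertex (head G e)] @ map Edge es)) \<in> igs_cong G"
      by (intro igs_cong_append g f 1)
    moreover have "(Some (rev (map Ghost es) @ [Vertex (head G e)] @ map Edge es),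
           Some (rev (map Ghost es) @ map Edge es)) \<in> igs_cong G"
      using igs_cong_append[OF g edges_absorb_source[OF assms(1) es False]] by simp
    ultimately show ?thesis
      using Cons.IH[OF es False] by (auto intro: igs_cong.trans)
  qed
qed

lemma path_elem_star_idempotent:
  assumes "wf_digraph G" "p \<in> dpaths G"
  defines "f \<equiv> igs_mult G (path_elem G p) (path_star G p)"
  shows "f \<in> igs G" "igs_mult G f f = f"
proof -
  interpret wf_digraph G by fact
  obtain u es v where p: "p = (u, es)" and w: "awalk u es v"
    using assms(2) by (auto simp: dpaths_def)
  have u: "u \<in> verts G" and set_es: "set es \<subseteq> arcs G" using w by (auto simp: awalk_def)
  define a where "a = (if es = [] then [Vertex u] else map Edge es :: ('a, 'b) igs_gen list)"
  define b where "b = (if es = [] then [Vertex u] else rev (map Ghost es) :: ('a, 'b) igs_gen list)"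
  have a: "Some a \<in> free_sg0 (igs_gens G)" and b: "Some b \<in> free_sg0 (igs_gens G)"
    using u set_es by (auto simp: a_def b_def subset_iff)
  have ab: "Some (a @ b) \<in> free_sg0 (igs_gens G)" using a b by simp
  have f: "f = igs_class G (Some (a @ b))"
    using igs_mult_class[OF assms(1) a b]
    by (simp add: f_def path_elem_def path_star_def p a_def b_def cong: if_cong)
  then show "f \<in> igs G"
    using ab by (auto simp: igs_def igs_class_def intro: quotientI)
  have vv: "(Some [Vertex u, Vertex u], Some [Vertex u]) \<in> igs_cong G"
    by (intro igs_cong.base igs_rel.vertex_same u)
  have "(Some (a @ b @ a), Some a) \<in> igs_cong G"
  proof (cases "es = []")
    case True
    have "(Some ([Vertex u, Vertex u] @ [Vertex u]), Some ([Vertex u] @ [Vertex u])) \<in> igs_cong G"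
      using u by (intro igs_cong_append vv igs_cong.refl) auto
    from igs_cong.trans[OF this] vv show ?thesis by (simp add: True a_def b_def)
  next
    case False
    have "(Some (a @ b @ a), Some (a @ [Vertex v])) \<in> igs_cong G"
      using ghosts_edges_cancel[OF assms(1) w False] False
      by (intro igs_cong_append igs_cong.refl a) (simp add: a_def b_def)
    from igs_cong.trans[OF this] edges_absorb_range[OF assms(1) w False] False
    show ?thesis by (simp add: a_def)
  qed
  from igs_cong_append[OF this igs_cong.refl[OF b]]
  have "(Some ((a @ b) @ (a @ b)), Some (a @ b)) \<in> igs_cong G" by simp
  then show "igs_mult G f f = f"
    using igs_mult_class[OF assms(1) ab ab] igs_class_eqI[OF assms(1)] by (simp add: f)
qed

end

theory Submission
  imports Defs
begin

text \<open>
  Both inclusions come from \<open>p\<^sup>*p = r(p)\<close>. For an arbitrary \<open>x\<close>, regroup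
  \<open>pp\<^sup>* x pp\<^sup>* = p (p\<^sup>*xp) p\<^sup>*\<close>. The middle factor is an element of the semigroup, hence is zero or
  of the form \<open>\<mu>\<nu>\<^sup>*\<close> with \<open>r(\<mu>) = r(\<nu>)\<close> (lemma \<open>normal_form\<close>), so the product is
  \<open>(p\<mu>)(\<nu>\<^sup>*p\<^sup>*)\<close>. Here \<open>p\<mu>\<close> is zero unless \<open>s(\<mu>) = r(p)\<close>, and \<open>\<nu>\<^sup>*p\<^sup>*\<close> is zero unless
  \<open>s(\<nu>) = r(p)\<close>; in the remaining case the product is \<open>(p\<mu>)(p\<nu>)\<^sup>*\<close>. Regrouping first avoids
  comparing \<open>p\<close> with the paths that occur in \<open>x\<close>. Conversely, \<open>pp\<^sup>*(p\<mu>) = p\<mu>\<close> and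
  \<open>(p\<nu>)\<^sup>*pp\<^sup>* = (p\<nu>)\<^sup>*\<close>, so \<open>(p\<mu>)(p\<nu>)\<^sup>*\<close> is fixed by multiplication with \<open>pp\<^sup>*\<close> on both sides.

  The normal form is an existence statement about words in the generators, proved by induction on
  the length of the word: the set of the elements \<open>0\<close> and \<open>\<mu>\<nu>\<^sup>*\<close> contains the vertices and is
  stable under left multiplication by generators (lemma \<open>generator_mult_normal\<close>).

  Statements about formal inverses of paths are obtained from statements about paths through the
  involution that reverses a word and exchanges each edge with its inverse; the defining
  relations are invariant under it (lemma \<open>word_inv_cong\<close>).
\<close>

section \<open>The involution on words\<close>

fun gen_inv :: "('a, 'b) igs_gen \<Rightarrow> ('a, 'b) igs_gen" where
  "gen_inv (Vertex v) = Vertex v"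
| "gen_inv (Edge e) = Ghost e"
| "gen_inv (Ghost e) = Edge e"

definition word_inv :: "('a, 'b) igs_gen list option \<Rightarrow> ('a, 'b) igs_gen list option" where
  "word_inv = map_option (\<lambda>w. rev (map gen_inv w))"

definition igs_inv :: "('a, 'b) igs_elem \<Rightarrow> ('a, 'b) igs_elem" where
  "igs_inv X = word_inv ` X"

lemma gen_inv_gen_inv [simp]: "gen_inv (gen_inv x) = x"
  by (cases x) auto

lemma gen_inv_igs_gens [simp]: "gen_inv x \<in> igs_gens G \<longleftrightarrow> x \<in> igs_gens G"
  by (cases x) auto

lemma gen_src_inv [simp]: "gen_src G (gen_inv x) = gen_rng G x"
  by (cases x) auto

lemma gen_rng_inv [simp]: "gen_rng G (gen_inv x) = gen_src G x"
  by (cases x) auto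

lemma word_inv_word_inv [simp]: "word_inv (word_inv w) = w"
  by (cases w) (simp_all add: word_inv_def rev_map comp_def)

lemma word_inv_closed [simp]:
  "word_inv w \<in> free_sg0 (igs_gens G) \<longleftrightarrow> w \<in> free_sg0 (igs_gens G)"
  by (cases w) (auto simp: word_inv_def)

lemma word_inv_free_mult: "word_inv (free_mult x y) = free_mult (word_inv y) (word_inv x)"
  by (cases x; cases y) (simp_all add: word_inv_def)

text \<open>
  The involution exchanges the source relations with the range relations and maps each of the
  other kinds of relations to itself.
\<close>

lemma word_inv_rel:
  assumes "(x, y) \<in> igs_rel G"
  shows "(word_inv x, word_inv y) \<in> igs_rel G"
  using assms
proof cases
  case (src x)
  then show ?thesis using igs_rel.rng[of "gen_inv x" G] by (simp add: word_inv_def)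
next
  case (rng x)
  then show ?thesis using igs_rel.src[of "gen_inv x" G] by (simp add: word_inv_def)
qed (auto simp: word_inv_def intro: igs_rel.intros)

lemma word_inv_cong:
  assumes "(x, y) \<in> igs_cong G"
  shows "(word_inv x, word_inv y) \<in> igs_cong G"
  using assms
proof induction
  case (mult x x' y y')
  then show ?case by (simp add: word_inv_free_mult igs_cong.mult)
qed (auto intro: igs_cong.intros word_inv_rel)

lemma igs_inv_class: "igs_inv (igs_class G w) = igs_class G (word_inv w)"
proof
  show "igs_inv (igs_class G w) \<subseteq> igs_class G (word_inv w)"
    by (auto simp: igs_inv_def igs_class_def intro: word_inv_cong)
  show "igs_class G (word_inv w) \<subseteq> igs_inv (igs_class G w)"
  proof
    fix z assume "z \<in> igs_class G (word_inv w)"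
    then have "word_inv z \<in> igs_class G w"
      using word_inv_cong[of "word_inv w" z G] by (simp add: igs_class_def)
    then show "z \<in> igs_inv (igs_class G w)"
      unfolding igs_inv_def by (metis image_eqI word_inv_word_inv)
  qed
qed

lemma igs_inv_zero: "igs_inv (igs_zero G) = igs_zero G"
  by (simp add: igs_zero_def igs_inv_class) (simp add: word_inv_def)

lemma igs_inv_path_elem: "igs_inv (path_elem G p) = path_star G p"
  by (simp add: path_elem_def path_star_def igs_inv_class)
    (simp add: word_inv_def rev_map comp_def)

lemma igs_inv_path_star: "igs_inv (path_star G p) = path_elem G p"
  by (simp add: igs_inv_path_elem[symmetric]) (simp add: igs_inv_def image_image)

section \<open>The graph inverse semigroup as a semigroup with zero\<close>

context wf_digraph
begin

lemma image_igs_gens_iff [simp]: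
  "Edge ` A \<subseteq> igs_gens G \<longleftrightarrow> A \<subseteq> arcs G"
  "Ghost ` A \<subseteq> igs_gens G \<longleftrightarrow> A \<subseteq> arcs G"
  by (auto simp: subset_iff)

abbreviation gmult (infixl "\<odot>" 70) where
  "X \<odot> Y \<equiv> igs_mult G X Y"

abbreviation vertex_elem :: "'a \<Rightarrow> ('a, 'b) igs_elem" where
  "vertex_elem v \<equiv> path_elem G (v, [])"

lemma igs_class_closed [simp]:
  "w \<in> free_sg0 (igs_gens G) \<Longrightarrow> igs_class G w \<in> igs G"
  by (auto simp: igs_def igs_class_def intro: quotientI)

lemma igsE:
  assumes "X \<in> igs G"
  obtains w where "w \<in> free_sg0 (igs_gens G)" "X = igs_class G w"
  using assms by (auto simp: igs_def igs_class_def elim: quotientE)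

lemma class_mult:
  "x \<in> free_sg0 (igs_gens G) \<Longrightarrow> y \<in> free_sg0 (igs_gens G) \<Longrightarrow>
    igs_class G x \<odot> igs_class G y = igs_class G (free_mult x y)"
  by (rule igs_mult_class[OF wf_digraph_axioms])

lemma class_eqI: "(x, y) \<in> igs_cong G \<Longrightarrow> igs_class G x = igs_class G y"
  by (rule igs_class_eqI[OF wf_digraph_axioms])

lemma mult_closed [simp]: "X \<in> igs G \<Longrightarrow> Y \<in> igs G \<Longrightarrow> X \<odot> Y \<in> igs G"
  by (elim igsE) (simp add: class_mult free_mult_closed)

lemma mult_assoc:
  "X \<in> igs G \<Longrightarrow> Y \<in> igs G \<Longrightarrow> Z \<in> igs G \<Longrightarrow> X \<odot> Y \<odot> Z = X \<odot> (Y \<odot> Z)"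
  by (elim igsE) (simp add: class_mult free_mult_closed free_mult_assoc)

lemma zero_closed [simp]: "igs_zero G \<in> igs G"
  by (simp add: igs_zero_def)

lemma mult_zero_left [simp]: "X \<in> igs G \<Longrightarrow> igs_zero G \<odot> X = igs_zero G"
  by (elim igsE) (simp add: igs_zero_def class_mult)

lemma mult_zero_right [simp]: "X \<in> igs G \<Longrightarrow> X \<odot> igs_zero G = igs_zero G"
  by (elim igsE) (simp add: igs_zero_def class_mult)

lemma igs_inv_mult: "X \<in> igs G \<Longrightarrow> Y \<in> igs G \<Longrightarrow> igs_inv (X \<odot> Y) = igs_inv Y \<odot> igs_inv X"
  by (elim igsE) (simp add: class_mult igs_inv_class word_inv_free_mult)

section \<open>Products of paths and of their inverses\<close>

lemma dpathsE:
  assumes "p \<in> dpaths G"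
  obtains u es where "p = (u, es)" "awalk u es (path_rng G p)"
proof -
  obtain u es v where "p = (u, es)" "awalk u es v"
    using assms by (auto simp: dpaths_def)
  then show thesis using that awalk_ends by (auto simp: path_rng_def)
qed

lemma awalk_dpath: "awalk u es v \<Longrightarrow> (u, es) \<in> dpaths G \<and> path_rng G (u, es) = v"
  by (auto simp: dpaths_def path_rng_def)

lemma path_src_verts: "p \<in> dpaths G \<Longrightarrow> path_src p \<in> verts G"
  by (elim dpathsE) (auto simp: path_src_def awalk_def)

lemma path_rng_verts: "p \<in> dpaths G \<Longrightarrow> path_rng G p \<in> verts G"
  by (elim dpathsE) auto

lemma trivial_dpath [simp]: "(v, []) \<in> dpaths G \<longleftrightarrow> v \<in> verts G"
  by (auto simp: dpaths_def awalk_Nil_iff)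

lemma path_rng_trivial [simp]: "path_rng G (v, []) = v"
  by (simp add: path_rng_def)

lemma arc_dpath:
  assumes "e \<in> arcs G"
  shows "(tail G e, [e]) \<in> dpaths G" "path_rng G (tail G e, [e]) = head G e"
  using arc_implies_awalk[OF assms] awalk_dpath by auto

lemma path_cat_dpath:
  assumes "p \<in> dpaths G" "q \<in> dpaths G" "path_rng G p = path_src q"
  shows "path_cat p q \<in> dpaths G" "path_rng G (path_cat p q) = path_rng G q"
proof -
  obtain u es where p: "p = (u, es)" "awalk u es (path_rng G p)"
    using assms(1) by (rule dpathsE)
  obtain v fs where q: "q = (v, fs)" "awalk v fs (path_rng G q)"
    using assms(2) by (rule dpathsE)
  have "awalk u (es @ fs) (path_rng G q)"
    using p q assms(3) by (auto simp: path_src_def)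
  from awalk_dpath[OF this]
  show "path_cat p q \<in> dpaths G" "path_rng G (path_cat p q) = path_rng G q"
    using p(1) q(1) by (auto simp: path_cat_def)
qed

lemma path_elem_closed [simp]: "p \<in> dpaths G \<Longrightarrow> path_elem G p \<in> igs G"
  by (rule path_elem_star_closed[OF wf_digraph_axioms])

lemma path_star_closed [simp]: "p \<in> dpaths G \<Longrightarrow> path_star G p \<in> igs G"
  by (rule path_elem_star_closed[OF wf_digraph_axioms])

lemma path_star_trivial: "path_star G (v, []) = vertex_elem v"
  by (simp add: path_star_def path_elem_def)

lemma vertex_mult:
  assumes "u \<in> verts G" "v \<in> verts G"
  shows "vertex_elem u \<odot> vertex_elem v = (if u = v then vertex_elem u else igs_zero G)"
  using assms class_eqI[OF igs_cong.base[OF igs_rel.vertex_same[of u G]]]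
    class_eqI[OF igs_cong.base[OF igs_rel.vertex_diff[of u G v]]]
  by (auto simp: path_elem_def igs_zero_def class_mult)

lemma source_mult_path:
  assumes "p \<in> dpaths G"
  shows "vertex_elem (path_src p) \<odot> path_elem G p = path_elem G p"
proof -
  obtain u es where p: "p = (u, es)" and w: "awalk u es (path_rng G p)"
    using assms by (rule dpathsE)
  have u: "u \<in> verts G" "set es \<subseteq> arcs G" using w by (auto simp: awalk_def)
  show ?thesis
  proof (cases "es = []")
    case True
    then show ?thesis using u vertex_mult[of u u] by (simp add: p path_src_def)
  next
    case False
    then show ?thesis
      using u class_eqI[OF edges_absorb_source[OF wf_digraph_axioms w False]]
      by (simp add: p path_src_def path_elem_def class_mult)
  qed
qed

lemma path_mult_range:
  assumes "p \<in> dpaths G"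
  shows "path_elem G p \<odot> vertex_elem (path_rng G p) = path_elem G p"
proof -
  obtain u es where p: "p = (u, es)" and w: "awalk u es (path_rng G p)"
    using assms by (rule dpathsE)
  have u: "u \<in> verts G" "set es \<subseteq> arcs G" using w by (auto simp: awalk_def)
  show ?thesis
  proof (cases "es = []")
    case True
    then show ?thesis using u vertex_mult[of u u] by (simp add: p)
  next
    case False
    then show ?thesis
      using u path_rng_verts[OF assms] class_eqI[OF edges_absorb_range[OF wf_digraph_axioms w False]]
      by (simp add: p path_elem_def class_mult)
  qed
qed

text \<open>
  When the ends do not match, inserting the two end vertices between the factors exposes a product
  of distinct vertices.
\<close>

lemma path_mult:
  assumes p: "p \<in> dpaths G" and q: "q \<in> dpaths G"
  shows "path_elem G p \<odot> path_elem G q =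
    (if path_rng G p = path_src q then path_elem G (path_cat p q) else igs_zero G)"
proof (cases "path_rng G p = path_src q")
  case True
  obtain u es where pu: "p = (u, es)" "awalk u es (path_rng G p)" using p by (rule dpathsE)
  obtain v fs where qv: "q = (v, fs)" "awalk v fs (path_rng G q)" using q by (rule dpathsE)
  have arcs: "set es \<subseteq> arcs G" "set fs \<subseteq> arcs G" using pu qv by (auto simp: awalk_def)
  consider "es = []" | "fs = []" | "es \<noteq> []" "fs \<noteq> []" by blast
  then show ?thesis
  proof cases
    case 1
    then show ?thesis
      using source_mult_path[OF q] True pu qv by (simp add: path_cat_def path_src_def)
  next
    case 2
    then show ?thesis
      using path_mult_range[OF p] True pu qv by (simp add: path_cat_def path_src_def)
  next
    case 3
    then show ?thesis
      using arcs True by (simp add: pu(1) qv(1) path_cat_def path_elem_def class_mult)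
  qed
next
  case False
  let ?v = "vertex_elem (path_rng G p)" and ?w = "vertex_elem (path_src q)"
  have v: "?v \<in> igs G" "?w \<in> igs G" using path_rng_verts[OF p] path_src_verts[OF q] by simp_all
  have "path_elem G p \<odot> path_elem G q = (path_elem G p \<odot> ?v) \<odot> (?w \<odot> path_elem G q)"
    using p q by (simp add: path_mult_range source_mult_path)
  also have "\<dots> = path_elem G p \<odot> (?v \<odot> ?w) \<odot> path_elem G q"
    using p q v by (simp add: mult_assoc)
  also have "?v \<odot> ?w = igs_zero G"
    using False vertex_mult path_rng_verts[OF p] path_src_verts[OF q] by simp
  finally show ?thesis using False p q by simp
qed

lemma star_mult:
  assumes "p \<in> dpaths G" "q \<in> dpaths G"
  shows "path_star G q \<odot> path_star G p =
    (if path_rng G p = path_src q then path_star G (path_cat p q) else igs_zero G)"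
  using arg_cong[OF path_mult[OF assms], of igs_inv] assms
  by (auto simp: igs_inv_mult igs_inv_path_elem igs_inv_zero split: if_splits)

lemma range_mult_star:
  assumes "p \<in> dpaths G"
  shows "vertex_elem (path_rng G p) \<odot> path_star G p = path_star G p"
  using arg_cong[OF path_mult_range[OF assms], of igs_inv] assms path_rng_verts[OF assms]
  by (simp add: igs_inv_mult igs_inv_path_elem path_star_trivial)

lemma star_mult_path:
  assumes "p \<in> dpaths G"
  shows "path_star G p \<odot> path_elem G p = vertex_elem (path_rng G p)"
proof -
  obtain u es where p: "p = (u, es)" and w: "awalk u es (path_rng G p)"
    using assms by (rule dpathsE)
  have u: "u \<in> verts G" "set es \<subseteq> arcs G" using w by (auto simp: awalk_def)
  show ?thesis
  proof (cases "es = []")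
    case True
    then show ?thesis using u vertex_mult[of u u] by (simp add: p path_star_trivial)
  next
    case False
    then show ?thesis
      using u class_eqI[OF ghosts_edges_cancel[OF wf_digraph_axioms w False]]
      by (simp add: p path_elem_def path_star_def class_mult)
  qed
qed

lemma ghost_mult_edge:
  assumes "e \<in> arcs G" "f \<in> arcs G" "e \<noteq> f"
  shows "path_star G (tail G e, [e]) \<odot> path_elem G (tail G f, [f]) = igs_zero G"
  using assms class_eqI[OF igs_cong.base[OF igs_rel.ghost_diff[OF assms]]]
  by (simp add: path_elem_def path_star_def igs_zero_def class_mult)

section \<open>Normal forms\<close>

definition normal_elems :: "('a, 'b) igs_elem set" where
  "normal_elems = insert (igs_zero G)
    {path_elem G \<mu> \<odot> path_star G \<nu> | \<mu> \<nu>.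
      \<mu> \<in> dpaths G \<and> \<nu> \<in> dpaths G \<and> path_rng G \<mu> = path_rng G \<nu>}"

lemma zero_normal [simp]: "igs_zero G \<in> normal_elems"
  by (simp add: normal_elems_def)

lemma normalI:
  "\<mu> \<in> dpaths G \<Longrightarrow> \<nu> \<in> dpaths G \<Longrightarrow> path_rng G \<mu> = path_rng G \<nu> \<Longrightarrow>
    path_elem G \<mu> \<odot> path_star G \<nu> \<in> normal_elems"
  unfolding normal_elems_def by blast

lemma star_normal:
  assumes "\<nu> \<in> dpaths G"
  shows "path_star G \<nu> \<in> normal_elems"
  using normalI[of "(path_rng G \<nu>, [])" \<nu>] assms
  by (simp add: range_mult_star path_rng_verts)

lemma path_mult_normal:
  assumes q: "q \<in> dpaths G" and X: "X \<in> normal_elems"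
  shows "path_elem G q \<odot> X \<in> normal_elems"
proof (cases "X = igs_zero G")
  case True
  then show ?thesis using q by simp
next
  case False
  then obtain \<mu> \<nu> where *: "\<mu> \<in> dpaths G" "\<nu> \<in> dpaths G" "path_rng G \<mu> = path_rng G \<nu>"
    "X = path_elem G \<mu> \<odot> path_star G \<nu>"
    using X by (auto simp: normal_elems_def)
  have "path_elem G q \<odot> X = (path_elem G q \<odot> path_elem G \<mu>) \<odot> path_star G \<nu>"
    using q * by (simp add: mult_assoc)
  then show ?thesis
    using q * by (auto simp: path_mult path_cat_dpath intro!: normalI)
qed

text \<open>
  The inverse of an edge \<open>e\<close> meets \<open>\<mu>\<nu>\<^sup>*\<close> in one of two ways. If \<open>\<mu>\<close> has a first edge, that edge
  is either cancelled or makes the product zero. If \<open>\<mu>\<close> is trivial, then \<open>e\<^sup>*\<nu>\<^sup>*\<close> is zero or the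
  inverse of the longer path \<open>\<nu>e\<close>.
\<close>

lemma ghost_mult_normal:
  assumes e: "e \<in> arcs G" and X: "X \<in> normal_elems"
  shows "path_star G (tail G e, [e]) \<odot> X \<in> normal_elems"
proof (cases "X = igs_zero G")
  case True
  then show ?thesis using arc_dpath[OF e] by simp
next
  case False
  then obtain \<mu> \<nu> where *: "\<mu> \<in> dpaths G" "\<nu> \<in> dpaths G" "path_rng G \<mu> = path_rng G \<nu>"
    "X = path_elem G \<mu> \<odot> path_star G \<nu>"
    using X by (auto simp: normal_elems_def)
  let ?e = "(tail G e, [e])"
  note e' = arc_dpath[OF e]
  obtain u es where \<mu>: "\<mu> = (u, es)" "awalk u es (path_rng G \<mu>)" using *(1) by (rule dpathsE)
  show ?thesis
  proof (cases es)
    case Nil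
    then have "X = path_star G \<nu>"
      using * \<mu> range_mult_star[OF *(2)] by simp
    then have "path_star G ?e \<odot> X =
      (if path_rng G \<nu> = tail G e then path_star G (path_cat \<nu> ?e) else igs_zero G)"
      using star_mult[OF *(2) e'(1)] by (simp add: path_src_def)
    then show ?thesis
      using path_cat_dpath[OF *(2) e'(1)] by (auto simp: path_src_def intro: star_normal)
  next
    case (Cons f fs)
    let ?f = "(tail G f, [f])" and ?\<mu> = "(head G f, fs)"
    have f: "f \<in> arcs G" "u = tail G f" and w: "awalk (head G f) fs (path_rng G \<mu>)"
      using \<mu>(2) by (auto simp: Cons awalk_Cons_iff)
    note f' = arc_dpath[OF f(1)] and fs = awalk_dpath[OF w]
    have "path_elem G \<mu> = path_elem G ?f \<odot> path_elem G ?\<mu>"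
      using path_mult[OF f'(1), of ?\<mu>] fs f f'(2)
      by (simp add: path_src_def path_cat_def \<mu>(1) Cons)
    then have eq: "path_star G ?e \<odot> X =
      (path_star G ?e \<odot> path_elem G ?f) \<odot> (path_elem G ?\<mu> \<odot> path_star G \<nu>)"
      using * e'(1) f'(1) fs by (simp add: mult_assoc)
    have tl: "path_elem G ?\<mu> \<odot> path_star G \<nu> \<in> normal_elems"
      using fs * by (intro normalI) auto
    show ?thesis
    proof (cases "e = f")
      case True
      then have "path_star G ?e \<odot> X = vertex_elem (head G e) \<odot> (path_elem G ?\<mu> \<odot> path_star G \<nu>)"
        using eq star_mult_path[OF e'(1)] e'(2) by simp
      then show ?thesis
        using path_mult_normal[OF _ tl, of "(head G e, [])"] e by simp
    next
      case False
      then show ?thesis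
        using eq ghost_mult_edge[OF e f(1)] fs *(2) by simp
    qed
  qed
qed

lemma generator_mult_normal:
  assumes "x \<in> igs_gens G" "X \<in> normal_elems"
  shows "igs_class G (Some [x]) \<odot> X \<in> normal_elems"
proof (cases x)
  case (Vertex v)
  then show ?thesis
    using path_mult_normal[of "(v, [])" X] assms by (simp add: path_elem_def)
next
  case (Edge e)
  then show ?thesis
    using path_mult_normal[OF arc_dpath(1) assms(2), of e] assms by (simp add: path_elem_def)
next
  case (Ghost e)
  then show ?thesis
    using ghost_mult_normal[of e X] assms by (simp add: path_star_def)
qed

lemma normal_form:
  assumes "X \<in> igs G"
  shows "X \<in> normal_elems"
proof -
  have word: "igs_class G (Some w) \<in> normal_elems" if "w \<noteq> []" "set w \<subseteq> igs_gens G" for w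
    using that
  proof (induction w)
    case Nil
    then show ?case by simp
  next
    case (Cons x w)
    have x: "x \<in> igs_gens G" using Cons.prems by simp
    show ?case
    proof (cases "w = []")
      case True
      have v: "gen_rng G x \<in> verts G" using x by (cases x) auto
      have "igs_class G (Some [x]) = igs_class G (Some [x]) \<odot> vertex_elem (gen_rng G x)"
        using x v class_eqI[OF igs_cong.base[OF igs_rel.rng[OF x]]]
        by (simp add: path_elem_def class_mult)
      moreover have "vertex_elem (gen_rng G x) \<in> normal_elems"
        using star_normal[of "(gen_rng G x, [])"] v by (simp add: path_star_trivial)
      ultimately show ?thesis using True generator_mult_normal[OF x] by metis
    next
      case False
      then have "igs_class G (Some (x # w)) = igs_class G (Some [x]) \<odot> igs_class G (Some w)"
        using Cons.prems by (simp add: class_mult)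
      then show ?thesis using generator_mult_normal[OF x] Cons False by simp
    qed
  qed
  obtain w where "w \<in> free_sg0 (igs_gens G)" "X = igs_class G w" using assms by (rule igsE)
  then show ?thesis using word by (cases w) (auto simp: igs_zero_def[symmetric])
qed

section \<open>Local submonoids\<close>

lemma idempotent_mult_path:
  assumes p: "p \<in> dpaths G" and \<mu>: "\<mu> \<in> dpaths G" "path_src \<mu> = path_rng G p"
  shows "path_elem G p \<odot> path_star G p \<odot> path_elem G (path_cat p \<mu>) = path_elem G (path_cat p \<mu>)"
proof -
  have "path_elem G p \<odot> path_star G p \<odot> (path_elem G p \<odot> path_elem G \<mu>) =
    path_elem G p \<odot> (path_star G p \<odot> path_elem G p) \<odot> path_elem G \<mu>"
    using p \<mu> by (simp add: mult_assoc)
  also have "\<dots> = path_elem G p \<odot> path_elem G \<mu>"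
    using p by (simp add: star_mult_path path_mult_range)
  finally show ?thesis using p \<mu> by (simp add: path_mult)
qed

lemma star_mult_idempotent:
  assumes "p \<in> dpaths G" "\<nu> \<in> dpaths G" "path_src \<nu> = path_rng G p"
  shows "path_star G (path_cat p \<nu>) \<odot> (path_elem G p \<odot> path_star G p) = path_star G (path_cat p \<nu>)"
  using arg_cong[OF idempotent_mult_path[OF assms], of igs_inv] assms
  by (simp add: igs_inv_mult igs_inv_path_elem igs_inv_path_star path_cat_dpath)

theorem local_submonoid_path_idempotent:
  assumes p: "p \<in> dpaths G"
  shows "local_submonoid G (path_elem G p \<odot> path_star G p) =
    {igs_zero G} \<union>
    {path_elem G (path_cat p \<mu>) \<odot> path_star G (path_cat p \<nu>) | \<mu> \<nu>.
       \<mu> \<in> dpaths G \<and> \<nu> \<in> dpaths G \<and> path_rng G \<mu> = path_rng G \<nu> \<and>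
       path_src \<mu> = path_src \<nu> \<and> path_src \<nu> = path_rng G p}" (is "?L = ?R")
proof
  let ?f = "path_elem G p \<odot> path_star G p"
  have f: "?f \<in> igs G" using p by simp
  show "?L \<subseteq> ?R"
  proof
    fix Y assume "Y \<in> ?L"
    then obtain X where X: "X \<in> igs G" and Y: "Y = ?f \<odot> X \<odot> ?f"
      by (auto simp: local_submonoid_def)
    let ?Z = "path_star G p \<odot> X \<odot> path_elem G p"
    have Y': "Y = path_elem G p \<odot> ?Z \<odot> path_star G p"
      using X p by (simp add: Y mult_assoc)
    have "?Z \<in> normal_elems" using X p by (intro normal_form) simp
    then consider "?Z = igs_zero G" |
      (paths) \<mu> \<nu> where "\<mu> \<in> dpaths G" "\<nu> \<in> dpaths G" "path_rng G \<mu> = path_rng G \<nu>"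
        "?Z = path_elem G \<mu> \<odot> path_star G \<nu>"
      by (auto simp: normal_elems_def)
    then show "Y \<in> ?R"
    proof cases
      case 1
      then show ?thesis using Y' p by simp
    next
      case paths
      have "Y = (path_elem G p \<odot> path_elem G \<mu>) \<odot> (path_star G \<nu> \<odot> path_star G p)"
        using paths p by (simp add: Y' mult_assoc)
      also have "\<dots> \<in> ?R"
      proof (cases "path_src \<mu> = path_rng G p \<and> path_src \<nu> = path_rng G p")
        case True
        then have src: "path_src \<mu> = path_src \<nu>" "path_src \<nu> = path_rng G p" by simp_all
        then have "path_elem G p \<odot> path_elem G \<mu> \<odot> (path_star G \<nu> \<odot> path_star G p) =
          path_elem G (path_cat p \<mu>) \<odot> path_star G (path_cat p \<nu>)"
          using paths p by (simp add: path_mult star_mult)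
        then show ?thesis using paths(1-3) src by blast
      next
        case False
        then have "path_elem G p \<odot> path_elem G \<mu> = igs_zero G \<or>
          path_star G \<nu> \<odot> path_star G p = igs_zero G"
          using paths p by (auto simp: path_mult star_mult)
        then have "path_elem G p \<odot> path_elem G \<mu> \<odot> (path_star G \<nu> \<odot> path_star G p) = igs_zero G"
          using paths p by (elim disjE) simp_all
        then show ?thesis by simp
      qed
      finally show ?thesis .
    qed
  qed
  show "?R \<subseteq> ?L"
  proof
    fix Y assume "Y \<in> ?R"
    then consider "Y = igs_zero G" |
      (paths) \<mu> \<nu> where "\<mu> \<in> dpaths G" "\<nu> \<in> dpaths G"
        "path_src \<mu> = path_rng G p" "path_src \<nu> = path_rng G p"
        "Y = path_elem G (path_cat p \<mu>) \<odot> path_star G (path_cat p \<nu>)"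
      by auto
    then have "Y \<in> igs G \<and> ?f \<odot> Y \<odot> ?f = Y"
    proof cases
      case 1
      then show ?thesis using f by simp
    next
      case paths
      let ?a = "path_elem G (path_cat p \<mu>)" and ?b = "path_star G (path_cat p \<nu>)"
      have ab: "?a \<in> igs G" "?b \<in> igs G" using paths p by (simp_all add: path_cat_dpath)
      have "?f \<odot> Y \<odot> ?f = (?f \<odot> ?a) \<odot> (?b \<odot> ?f)"
        unfolding paths(5) using ab f by (simp only: mult_assoc mult_closed)
      also have "\<dots> = Y"
        using paths p by (simp add: idempotent_mult_path star_mult_idempotent)
      finally show ?thesis using ab paths(5) by simp
    qed
    then show "Y \<in> ?L" unfolding local_submonoid_def by (metis (mono_tags, lifting) mem_Collect_eq)
  qed
qed

end

theorem mainTheorem4: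
  fixes \<Gamma> :: "('a, 'b) pre_digraph" and p :: "('a, 'b) dpath"
  assumes "wf_digraph \<Gamma>" and "verts \<Gamma> \<noteq> {}" and "p \<in> dpaths \<Gamma>"
  shows "local_submonoid \<Gamma> (igs_mult \<Gamma> (path_elem \<Gamma> p) (path_star \<Gamma> p)) =
    {igs_zero \<Gamma>} \<union>
    {igs_mult \<Gamma> (path_elem \<Gamma> (path_cat p \<mu>)) (path_star \<Gamma> (path_cat p \<nu>)) | \<mu> \<nu>.
       \<mu> \<in> dpaths \<Gamma> \<and> \<nu> \<in> dpaths \<Gamma> \<and> path_rng \<Gamma> \<mu> = path_rng \<Gamma> \<nu> \<and>
       path_src \<mu> = path_src \<nu> \<and> path_src \<nu> = path_rng \<Gamma> p}"
  by (rule wf_digraph.local_submonoid_path_idempotent[OF assms(1,3)])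

end
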